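(* Assume: (a) $A:\mathcal H\rightrightarrows\mathcal H$ is maximally monotone, and there is $\beta>0$ such that for every $x\in\mathcal H$ the map $\xi\mapsto B(x,\xi)$ is $m_x$-measurable and $\beta$-Lipschitz; (b) there is $\theta>0$ such that for every $x\in\mathcal H$ and $m_x$-almost every $\xi\in\Xi$, $\theta\|B(y,\xi)-B(z,\xi)\|^2\le\langle B(y,\xi)-B(z,\xi),y-z\rangle$ for all $y,z\in\mathcal H$; (c) there is $\tau>0$ such that $\mathbb W_1(m_x,m_y)\le\tau\|x-y\|$ for all $x,y\in\mathcal H$; (d) $A$ is uniformly monotone with a modulus $\phi:[0,\infty)\to[0,\infty)$ that is continuous, strictly increasing, with $\phi(0)=0$, such that $t\mapsto\phi(t)/t$ is non-decreasing on $(0,\infty)$ and $\phi(t)>\beta\tau t^2$ for all $t>0$. Let $\gamma\in(0,2\theta)$. Then there exists a unique equilibrium point $\bar x\in\mathcal H$ such that $T^{m_{\bar x}}_{\lambda,\gamma}(\bar x)=0$ for all $\lambda>0$, or equivalently $\bar x=J_{\gamma A}(\bar x-\gamma B_{m_{\bar x}}(\bar x))$.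
   Context: $\mathcal H$ is a real Hilbert space, $\Xi$ a Polish space (with its complete metric), $(m_x)_{x\in\mathcal H}$ a family of probability measures on $\Xi$, $A:\mathcal H\rightrightarrows\mathcal H$ a set-valued operator and $B:\mathcal H\times\Xi\to\mathcal H$ single-valued. For a probability measure $m$ on $\Xi$, $B_m:\mathcal H\to\mathcal H$ is the single-valued operator $B_m(y)=\mathbb E_{\xi\sim m}[B(y,\xi)]$ (expectations are taken to be well defined). $J_{\gamma A}=(\mathrm{Id}+\gamma A)^{-1}$ is the resolvent, and for $\lambda,\gamma>0$, $T^{m}_{\lambda,\gamma}(x)=\frac1\lambda\left[x-J_{\gamma A}(x-\gamma B_m(x))\right]$. $\mathbb W_1(m_1,m_2)=\sup_{h}|\mathbb E_{\xi\sim m_1}[h(\xi)]-\mathbb E_{\eta\sim m_2}[h(\eta)]|$, the supremum over $1$-Lipschitz $h:\Xi\to\mathbb R$. $A$ is uniformly monotone with modulus $\phi$ (increasing, $\phi(0)=0$, $\lim_{t\to\infty}\phi(t)=\infty$) if $\langle x-y,u-v\rangle\ge\phi(\|x-y\|)$ whenever $u\in A(x)$, $v\in A(y)$. An equilibrium is a point $\bar x$ with $0\in A(\bar x)+B_{m_{\bar x}}(\bar x)$, equivalently $T^{m_{\bar x}}_{\lambda,\gamma}(\bar x)=0$ for all $\lambda,\gamma>0$. *)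

theory Defs
  imports "HOL-Probability.Probability"
begin

text \<open>
  A set-valued operator on a real Hilbert space \<open>'h\<close> is a function of type \<open>'h \<Rightarrow> 'h set\<close>.
\<close>

definition monotone_operator :: "('h::real_inner \<Rightarrow> 'h set) \<Rightarrow> bool" where
  "monotone_operator A \<longleftrightarrow>
    (\<forall>x y. \<forall>u\<in>A x. \<forall>v\<in>A y. 0 \<le> inner (x - y) (u - v))"

definition maximally_monotone :: "('h::real_inner \<Rightarrow> 'h set) \<Rightarrow> bool" where
  "maximally_monotone A \<longleftrightarrow>
    monotone_operator A \<and>
    (\<forall>A'. monotone_operator A' \<and> (\<forall>x. A x \<subseteq> A' x) \<longrightarrow> A' = A)"

text \<open>Only the values of the modulus on \<open>[0, \<infinity>)\<close> are relevant.\<close>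

definition uniformly_monotone :: "('h::real_inner \<Rightarrow> 'h set) \<Rightarrow> (real \<Rightarrow> real) \<Rightarrow> bool" where
  "uniformly_monotone A \<phi> \<longleftrightarrow>
    mono_on {0..} \<phi> \<and> \<phi> 0 = 0 \<and> filterlim \<phi> at_top at_top \<and>
    (\<forall>x y. \<forall>u\<in>A x. \<forall>v\<in>A y. \<phi> (norm (x - y)) \<le> inner (x - y) (u - v))"

text \<open>
  The resolvent \<open>(Id + C)\<inverse>\<close>. For maximally monotone \<open>C\<close> the set of solutions \<open>p\<close> of
  \<open>x \<in> p + C p\<close> is a singleton (Minty), and the resolvent at \<open>x\<close> is its only element.
\<close>

definition resolvent :: "('h::real_inner \<Rightarrow> 'h set) \<Rightarrow> 'h \<Rightarrow> 'h" where
  "resolvent C x = the_elem {p. x \<in> (\<lambda>u. p + u) ` C p}"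

definition scale_operator :: "real \<Rightarrow> ('h::real_inner \<Rightarrow> 'h set) \<Rightarrow> 'h \<Rightarrow> 'h set" where
  "scale_operator \<gamma> A x = (\<lambda>u. \<gamma> *\<^sub>R u) ` A x"

text \<open>
  The expectation of a Hilbert-space valued function is its Bochner integral.
  \<^const>\<open>has_bochner_integral\<close> is restricted to second-countable target spaces, that is, to separable
  Hilbert spaces; the following is the same definition without that restriction.
\<close>

definition has_expectation ::
    "'b measure \<Rightarrow> ('b \<Rightarrow> 'h::real_normed_vector) \<Rightarrow> 'h \<Rightarrow> bool" where
  "has_expectation M f v \<longleftrightarrow>
    f \<in> borel_measurable M \<and>
    (\<exists>s. (\<forall>i. Bochner_Integration.simple_bochner_integrable M (s i)) \<and>
         (\<lambda>i. \<integral>\<^sup>+\<xi>. ennreal (norm (f \<xi> - s i \<xi>)) \<partial>M) \<longlonglongrightarrow> 0 \<and>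
         (\<lambda>i::nat. Bochner_Integration.simple_bochner_integral M (s i)) \<longlonglongrightarrow> v)"

definition mean_operator ::
    "('h::real_normed_vector \<Rightarrow> 'b \<Rightarrow> 'h) \<Rightarrow> 'b measure \<Rightarrow> 'h \<Rightarrow> 'h" where
  "mean_operator B M y = (THE v. has_expectation M (B y) v)"

text \<open>
  The integrability conditions make both expectations meaningful (the library integral of a
  non-integrable function is 0). If both measures have finite first moment, every 1-Lipschitz
  function satisfies them, so that the supremum is over all 1-Lipschitz functions.
\<close>

definition wasserstein1 :: "'b::metric_space measure \<Rightarrow> 'b measure \<Rightarrow> ennreal" where
  "wasserstein1 M N =
    (SUP h \<in> {h :: 'b \<Rightarrow> real. 1-lipschitz_on UNIV h \<and> integrable M h \<and> integrable N h}.
       ennreal \<bar>(\<integral>\<xi>. h \<xi> \<partial>M) - (\<integral>\<eta>. h \<eta> \<partial>N)\<bar>)"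

definition fb_residual ::
    "('h::real_inner \<Rightarrow> 'h set) \<Rightarrow> ('h \<Rightarrow> 'b \<Rightarrow> 'h) \<Rightarrow> real \<Rightarrow> real \<Rightarrow> 'b measure \<Rightarrow> 'h \<Rightarrow> 'h" where
  "fb_residual A B l \<gamma> M x =
    (1 / l) *\<^sub>R (x - resolvent (scale_operator \<gamma> A) (x - \<gamma> *\<^sub>R mean_operator B M x))"

definition equilibrium ::
    "('h::real_inner \<Rightarrow> 'h set) \<Rightarrow> ('h \<Rightarrow> 'b \<Rightarrow> 'h) \<Rightarrow> ('h \<Rightarrow> 'b measure) \<Rightarrow> 'h \<Rightarrow> bool" where
  "equilibrium A B m x \<longleftrightarrow> 0 \<in> (\<lambda>u. u + mean_operator B (m x) x) ` A x"

end

theory Submission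
  imports Defs
begin

text \<open>
  Equilibria are the fixed points of \<open>F x = J (x - \<gamma> B\<^sub>m x)\<close>, where \<open>J\<close> is the resolvent of \<open>\<gamma> A\<close> and the
  measure \<open>m = m\<^sub>x\<close> varies with \<open>x\<close>. The explicit step is Lipschitz with constant \<open>L = 1 + \<gamma> \<beta> \<tau>\<close>: for a
  fixed measure it is nonexpansive, since \<open>B\<^sub>m\<close> inherits cocoercivity and \<open>\<gamma> < 2 \<theta>\<close>
  (\<open>mean_operator_cocoercive\<close>, \<open>forward_step_nonexpansive\<close>), while replacing \<open>m\<^sub>x\<close> by \<open>m\<^sub>y\<close> moves the mean by
  at most \<open>\<beta> \<tau> \<parallel>x - y\<parallel>\<close> by the dual form of the Wasserstein distance (\<open>mean_operator_wasserstein1\<close>). The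
  implicit step gains from uniform monotonicity (\<open>resolvent_uniformly_monotone\<close>). Together, for
  \<open>d = \<parallel>F x - F y\<parallel> > 0\<close>,

  \<open>d + \<gamma> \<phi>(d) / d \<le> (1 + \<gamma> \<beta> \<tau>) \<parallel>x - y\<parallel>\<close>.

  Since \<open>\<phi>(d) / d > \<beta> \<tau> d\<close>, the map \<open>F\<close> decreases distances strictly, but without a uniform factor, so
  Banach's theorem does not apply. Monotonicity of \<open>\<phi>(t) / t\<close> turns the inequality into the
  Meir--Keeler condition, which still yields a unique fixed point (\<open>Meir_Keeler_fixed_point\<close>).

  That the resolvent is defined everywhere is Minty's theorem (\<open>Minty\<close>). It is proved by minimising the
  Fitzpatrick function of the operator plus half the squared norm, a strongly convex problem whose
  minimising sequences converge by completeness alone.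
\<close>

section \<open>The Meir--Keeler fixed point theorem\<close>

text \<open>
  The condition forces distances to shrink strictly, so the steps of a Picard orbit decrease; an
  infimum \<open>r > 0\<close> of their lengths is impossible, since a step shorter than \<open>r + \<delta>\<close> is followed by one
  shorter than \<open>r\<close>. For the Cauchy property, once a step is shorter than \<open>\<delta>\<close>, the ball of radius
  \<open>\<epsilon> + \<delta>\<close> around the current iterate is mapped into itself: its image lies within \<open>\<epsilon>\<close> of the next
  iterate, which is within \<open>\<delta>\<close> of the current one.
\<close>
theorem Meir_Keeler_fixed_point:
  fixes F :: "'a::complete_space \<Rightarrow> 'a"
  assumes MK: "\<And>\<epsilon>. \<epsilon> > 0 \<Longrightarrow> \<exists>\<delta>>0. \<forall>x y. dist x y < \<epsilon> + \<delta> \<longrightarrow> dist (F x) (F y) < \<epsilon>"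
  shows "\<exists>!x. F x = x"
proof -
  have shrink: "dist (F x) (F y) < dist x y" if "x \<noteq> y" for x y
    using MK[of "dist x y"] that by force
  then have nonexp: "dist (F x) (F y) \<le> dist x y" for x y
    by (cases "x = y") (auto intro: less_imp_le)
  define X where "X n = (F ^^ n) undefined" for n
  have X_Suc: "X (Suc n) = F (X n)" for n
    by (simp add: X_def)
  define d where "d n = dist (X (Suc n)) (X n)" for n
  have small: "\<exists>n. d n < \<epsilon>" if "\<epsilon> > 0" for \<epsilon>
  proof (rule ccontr)
    assume none: "\<not> (\<exists>n. d n < \<epsilon>)"
    have bdd: "bdd_below (range d)"
      by (rule bdd_belowI[of _ 0]) (auto simp: d_def)
    define r where "r = (INF n. d n)"
    have "r \<ge> \<epsilon>"
      unfolding r_def using none by (intro cINF_greatest) (auto simp: not_less)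
    with that obtain \<delta> where \<delta>: "\<delta> > 0" "\<And>x y. dist x y < r + \<delta> \<Longrightarrow> dist (F x) (F y) < r"
      using MK[of r] by auto
    have "Inf (range d) < r + \<delta>"
      using \<delta>(1) by (simp add: r_def)
    then obtain n where "d n < r + \<delta>"
      by (subst (asm) cInf_less_iff) (use bdd in auto)
    then have "d (Suc n) < r"
      using \<delta>(2) by (simp add: d_def X_Suc)
    moreover have "r \<le> d (Suc n)"
      unfolding r_def using bdd by (intro cINF_lower) auto
    ultimately show False by simp
  qed
  have "Cauchy X"
  proof (rule metric_CauchyI)
    fix e :: real
    assume "e > 0"
    then obtain \<delta> where \<delta>: "\<delta> > 0" "\<And>x y. dist x y < e/4 + \<delta> \<Longrightarrow> dist (F x) (F y) < e/4"
      using MK[of "e/4"] by auto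
    define \<eta> where "\<eta> = min \<delta> (e/4)"
    have "\<eta> > 0"
      using \<delta>(1) \<open>e > 0\<close> by (simp add: \<eta>_def)
    then obtain N where N: "d N < \<eta>"
      using small by blast
    have near: "dist (X (N + k)) (X N) < e/4 + \<eta>" for k
    proof (induction k)
      case 0
      then show ?case using \<open>e > 0\<close> \<open>\<eta> > 0\<close> by simp
    next
      case (Suc k)
      then have "dist (X (N + k)) (X N) < e/4 + \<delta>"
        by (simp add: \<eta>_def)
      then have "dist (F (X (N + k))) (F (X N)) < e/4"
        by (rule \<delta>)
      moreover have "dist (F (X N)) (X N) < \<eta>"
        using N by (simp add: d_def X_Suc)
      ultimately show ?case
        using dist_triangle[of "X (N + Suc k)" "X N" "F (X N)"] by (simp add: X_Suc)
    qed
    have "dist (X i) (X N) < e/2" if "i \<ge> N" for i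
      using near[of "i - N"] that by (simp add: \<eta>_def)
    then have "dist (X i) (X j) < e" if "i \<ge> N" "j \<ge> N" for i j
      using that by (blast intro: dist_triangle_half_l)
    then show "\<exists>M. \<forall>i\<ge>M. \<forall>j\<ge>M. dist (X i) (X j) < e"
      by blast
  qed
  then obtain x where x: "X \<longlonglongrightarrow> x"
    using Cauchy_convergent convergentD by blast
  have "(\<lambda>n. dist (F (X n)) (F x)) \<longlonglongrightarrow> 0"
  proof (rule tendsto_sandwich[OF _ _ tendsto_const])
    show "(\<lambda>n. dist (X n) x) \<longlonglongrightarrow> 0"
      using x by (simp add: tendsto_dist_iff[symmetric])
  qed (auto simp: nonexp)
  then have "(\<lambda>n. X (Suc n)) \<longlonglongrightarrow> F x"
    by (simp add: tendsto_dist_iff[symmetric] X_Suc)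
  moreover have "(\<lambda>n. X (Suc n)) \<longlonglongrightarrow> x"
    using x by (rule LIMSEQ_Suc)
  ultimately have "F x = x"
    by (rule LIMSEQ_unique)
  moreover have "y = x" if "F y = y" for y
    using shrink[of y x] that \<open>F x = x\<close> by force
  ultimately show ?thesis
    by blast
qed

section \<open>Resolvents of maximally monotone operators\<close>

text \<open>
  The function \<open>r + \<parallel>z\<parallel>\<^sup>2 / 2\<close> is minimised over \<open>E\<close>, and the second conclusion is the first-order
  optimality condition. For the epigraph \<open>E\<close> of a convex function \<open>f\<close> this says that \<open>- z\<close> is a
  subgradient of \<open>f\<close> at \<open>z\<close>; the epigraph is used because \<open>f\<close> may take the value \<open>+\<infinity>\<close>. Strong convexity
  makes minimising sequences Cauchy, so the minimum is attained without any weak compactness.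
\<close>
lemma quadratic_minimiser:
  fixes E :: "('a::{real_inner, complete_space} \<times> real) set"
  assumes "closed E" "convex E" "E \<noteq> {}"
    and nonneg: "\<And>z r. (z, r) \<in> E \<Longrightarrow> 0 \<le> r + (norm z)\<^sup>2 / 2"
  obtains z r where "(z, r) \<in> E"
    and "\<And>w s. (w, s) \<in> E \<Longrightarrow> r - inner z (w - z) \<le> s"
proof -
  define q :: "'a \<times> real \<Rightarrow> real" where "q p = snd p + (norm (fst p))\<^sup>2 / 2" for p
  define I where "I = (INF p\<in>E. q p)"
  have bdd: "bdd_below (q ` E)"
    by (rule bdd_belowI[of _ 0]) (use nonneg in \<open>auto simp: q_def\<close>)
  have I_le: "I \<le> q p" if "p \<in> E" for p
    unfolding I_def using bdd that by (rule cINF_lower)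
  have "\<exists>p\<in>E. q p < I + 1 / Suc n" for n
    using cINF_less_iff[OF \<open>E \<noteq> {}\<close> bdd, of "I + 1 / Suc n"] by (simp add: I_def)
  then obtain p where pE: "p n \<in> E" and p_lt: "q (p n) < I + 1 / Suc n" for n
    by metis
  have q_lim: "(\<lambda>n. q (p n)) \<longlonglongrightarrow> I"
  proof (rule tendsto_sandwich)
    show "\<forall>\<^sub>F n in sequentially. I \<le> q (p n)"
      "\<forall>\<^sub>F n in sequentially. q (p n) \<le> I + 1 / real (Suc n)"
      using pE I_le less_imp_le[OF p_lt] by auto
    show "(\<lambda>n. I + 1 / real (Suc n)) \<longlonglongrightarrow> I"
      using tendsto_add[OF tendsto_const LIMSEQ_Suc[OF lim_const_over_n[of 1]], of I] by simp
  qed simp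
  \<comment> \<open>By the parallelogram identity, the midpoint of two points of \<open>E\<close> has an objective value lower
     than their average by an eighth of the squared distance, but it still cannot go below \<open>I\<close>.\<close>
  have near: "(norm (fst (p i) - fst (p j)))\<^sup>2 \<le> 4 * (1 / Suc i + 1 / Suc j)" for i j
  proof -
    define c where "c = (1/2) *\<^sub>R p i + (1/2) *\<^sub>R p j"
    have "c \<in> E"
      unfolding c_def by (intro convexD[OF \<open>convex E\<close> pE pE]) auto
    then have "I \<le> q c"
      by (rule I_le)
    also have "q c = (q (p i) + q (p j)) / 2 - (norm (fst (p i) - fst (p j)))\<^sup>2 / 8"
      by (simp add: q_def c_def power2_norm_eq_inner inner_add inner_diff inner_commute field_simps)
    finally show ?thesis
      using p_lt[of i] p_lt[of j] by argo
  qed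
  have "Cauchy (\<lambda>n. fst (p n))"
  proof (rule CauchyI)
    fix e :: real
    assume "e > 0"
    then obtain N where N: "1 / Suc N < e\<^sup>2 / 8"
      using nat_approx_posE[of "e\<^sup>2 / 8"] by auto
    have "norm (fst (p i) - fst (p j)) < e" if "i \<ge> N" "j \<ge> N" for i j
    proof -
      have "1 / Suc i \<le> 1 / Suc N" "1 / Suc j \<le> 1 / Suc N"
        using that by (auto intro!: divide_left_mono)
      with N near[of i j] have "(norm (fst (p i) - fst (p j)))\<^sup>2 < e\<^sup>2"
        by argo
      then show ?thesis
        using \<open>e > 0\<close> by (auto intro: power2_less_imp_less[OF _ less_imp_le])
    qed
    then show "\<exists>M. \<forall>m\<ge>M. \<forall>n\<ge>M. norm (fst (p m) - fst (p n)) < e"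
      by blast
  qed
  then obtain z where z: "(\<lambda>n. fst (p n)) \<longlonglongrightarrow> z"
    using Cauchy_convergent convergentD by blast
  define r where "r = I - (norm z)\<^sup>2 / 2"
  have "(\<lambda>n. q (p n) - (norm (fst (p n)))\<^sup>2 / 2) \<longlonglongrightarrow> r"
    unfolding r_def by (intro tendsto_intros q_lim z) auto
  then have "(\<lambda>n. snd (p n)) \<longlonglongrightarrow> r"
    by (simp add: q_def)
  with z have "(\<lambda>n. (fst (p n), snd (p n))) \<longlonglongrightarrow> (z, r)"
    by (rule tendsto_Pair)
  then have "p \<longlonglongrightarrow> (z, r)"
    by simp
  then have zr: "(z, r) \<in> E"
    by (rule closed_sequentially[OF \<open>closed E\<close> pE])
  have "r - inner z (w - z) \<le> s" if "(w, s) \<in> E" for w s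
  proof (rule ccontr)
    define a where "a = r - inner z (w - z) - s"
    define N where "N = (norm (w - z))\<^sup>2"
    assume "\<not> r - inner z (w - z) \<le> s"
    then have "a > 0"
      by (simp add: a_def)
    have "N \<ge> 0"
      by (simp add: N_def)
    \<comment> \<open>Moving from \<open>(z, r)\<close> towards \<open>(w, s)\<close> by a fraction \<open>t\<close> changes the objective by
       \<open>t * (t * N / 2 - a)\<close>; this step length makes the change negative.\<close>
    define t where "t = min 1 (a / (N + 1))"
    have t: "0 < t" "t \<le> 1"
      using \<open>a > 0\<close> \<open>N \<ge> 0\<close> by (auto simp: t_def)
    have "(1 - t) *\<^sub>R (z, r) + t *\<^sub>R (w, s) \<in> E"
      using t by (intro convexD[OF \<open>convex E\<close> zr that]) auto
    then have "I \<le> q ((1 - t) *\<^sub>R (z, r) + t *\<^sub>R (w, s))"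
      by (rule I_le)
    also have "\<dots> = I + t * (t * N / 2 - a)"
      unfolding q_def a_def r_def N_def power2_norm_eq_inner
      by (simp add: inner_add inner_diff inner_commute field_simps)
    finally have "0 \<le> t * (t * N / 2 - a)" by simp
    then have "a \<le> t * N / 2"
      using t by (simp add: zero_le_mult_iff)
    also have "\<dots> \<le> a / (N + 1) * (N + 1) / 2"
      using \<open>N \<ge> 0\<close> \<open>a > 0\<close> by (intro divide_right_mono mult_mono) (auto simp: t_def)
    also have "\<dots> = a / 2"
      using \<open>N \<ge> 0\<close> by simp
    finally show False
      using \<open>a > 0\<close> by simp
  qed
  with zr show ?thesis
    by (rule that)
qed

text \<open>
  The second part is maximality in pointwise form: a pair that is monotonically related to the whole
  graph belongs to it, because adding the pair would give a monotone extension.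
\<close>
lemma maximally_monotoneD:
  assumes "maximally_monotone A"
  shows "u \<in> A x \<Longrightarrow> v \<in> A y \<Longrightarrow> 0 \<le> inner (x - y) (u - v)"
    and "(\<And>y v. v \<in> A y \<Longrightarrow> 0 \<le> inner (x - y) (u - v)) \<Longrightarrow> u \<in> A x"
proof -
  have mono: "monotone_operator A"
    and max: "\<And>A'. monotone_operator A' \<Longrightarrow> (\<And>x. A x \<subseteq> A' x) \<Longrightarrow> A' = A"
    using assms unfolding maximally_monotone_def by auto
  show "0 \<le> inner (x - y) (u - v)" if "u \<in> A x" "v \<in> A y"
    using mono that unfolding monotone_operator_def by blast
  assume rel: "\<And>y v. v \<in> A y \<Longrightarrow> 0 \<le> inner (x - y) (u - v)"
  have rel': "0 \<le> inner (y - x) (v - u)" if "v \<in> A y" for y v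
    using rel[OF that] by (simp add: inner_diff algebra_simps)
  define A' where "A' = A(x := insert u (A x))"
  have "monotone_operator A'"
    using mono rel rel' by (auto simp: monotone_operator_def A'_def split: if_splits)
  then have "A' = A"
    by (rule max) (auto simp: A'_def)
  then show "u \<in> A x"
    unfolding A'_def by (metis fun_upd_same insertI1)
qed

text \<open>
  The set \<open>E\<close> in the proof is the epigraph of the Fitzpatrick function
  \<open>f (x, u) = (SUP (y, v) \<in> G. \<langle>x, v\<rangle> + \<langle>y, u\<rangle> - \<langle>y, v\<rangle>)\<close>. Monotonicity gives \<open>f (y, v) \<le> \<langle>y, v\<rangle>\<close> on \<open>G\<close>,
  maximality gives \<open>f (x, u) \<ge> \<langle>x, u\<rangle>\<close> everywhere, so that \<open>f + \<parallel>\<cdot>\<parallel>\<^sup>2 / 2\<close> is nonnegative. Optimality at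
  its minimiser \<open>(x, u)\<close>, tested on the points of the graph, becomes
  \<open>\<parallel>x + u\<parallel>\<^sup>2 \<le> \<langle>y + u, v + x\<rangle>\<close> for all \<open>(y, v) \<in> G\<close>. So \<open>(- u, - x)\<close> is in \<open>G\<close> by maximality, and testing
  on this very point yields \<open>x + u = 0\<close>.
\<close>
lemma Minty_graph:
  fixes G :: "('h::{real_inner, complete_space} \<times> 'h) set"
  assumes mono: "\<And>x u y v. (x, u) \<in> G \<Longrightarrow> (y, v) \<in> G \<Longrightarrow> 0 \<le> inner (x - y) (u - v)"
    and max: "\<And>x u. (\<And>y v. (y, v) \<in> G \<Longrightarrow> 0 \<le> inner (x - y) (u - v)) \<Longrightarrow> (x, u) \<in> G"
  shows "\<exists>x. (x, - x) \<in> G"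
proof -
  define E where "E = (\<Inter>(y, v)\<in>G. {p :: ('h \<times> 'h) \<times> real. inner ((v, y), -1) p \<le> inner y v})"
  have E_iff: "((x, u), r) \<in> E \<longleftrightarrow>
      (\<forall>(y, v)\<in>G. inner x v + inner y u - inner y v \<le> r)" for x u r
    by (auto simp: E_def inner_prod_def inner_commute algebra_simps)
  have graph_E: "((y, v), inner y v) \<in> E" if "(y, v) \<in> G" for y v
    using mono[OF that] by (force simp: E_iff inner_diff inner_commute algebra_simps)
  have E_ge: "inner x u \<le> r" if "((x, u), r) \<in> E" for x u r
  proof (cases "(x, u) \<in> G")
    case True
    then show ?thesis using that by (force simp: E_iff)
  next
    case False
    then obtain y v where "(y, v) \<in> G" "inner (x - y) (u - v) < 0"
      using max by (meson not_le)
    then show ?thesis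
      using that by (force simp: E_iff inner_diff algebra_simps)
  qed
  obtain x u r where xur: "((x, u), r) \<in> E"
    and min: "\<And>w s. (w, s) \<in> E \<Longrightarrow> r - inner (x, u) (w - (x, u)) \<le> s"
  proof (rule quadratic_minimiser[of E])
    show "closed E"
      unfolding E_def by (intro closed_INT) (auto simp: closed_halfspace_le)
    show "convex E"
      unfolding E_def by (intro convex_INT) (auto simp: convex_halfspace_le)
    show "E \<noteq> {}"
      \<comment> \<open>An empty graph is not maximal, as every pair is vacuously related to it.\<close>
      using graph_E max by (cases "G = {}") fastforce+
    show "0 \<le> r + (norm z)\<^sup>2 / 2" if "(z, r) \<in> E" for z r
    proof -
      obtain x u where z: "z = (x, u)" by force
      have "0 \<le> (norm (x + u))\<^sup>2" by simp
      also have "\<dots> = (norm z)\<^sup>2 + 2 * inner x u"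
        by (simp add: z power2_norm_eq_inner inner_add inner_prod_def inner_commute)
      finally show ?thesis
        using E_ge[of x u r] that by (simp add: z)
    qed
  qed auto
  have key: "(norm (x + u))\<^sup>2 \<le> inner (y + u) (v + x)" if "(y, v) \<in> G" for y v
    using min[OF graph_E[OF that]] E_ge[OF xur]
    by (simp add: power2_norm_eq_inner inner_add inner_diff inner_prod_def inner_commute)
  have "(- u, - x) \<in> G"
  proof (rule max)
    fix y v
    assume "(y, v) \<in> G"
    then have "0 \<le> inner (y + u) (v + x)"
      using key[of y v] zero_le_power2[of "norm (x + u)"] by linarith
    also have "\<dots> = inner (- u - y) (- x - v)"
      by (simp add: inner_add inner_diff)
    finally show "0 \<le> inner (- u - y) (- x - v)" .
  qed
  moreover from key[OF this] have "u = - x"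
    by (simp add: eq_neg_iff_add_eq_0 add.commute)
  ultimately show ?thesis
    by auto
qed

text \<open>
  Surjectivity of \<open>Id + \<gamma> A\<close>. Scaling by \<open>\<gamma>\<close> and translating by \<open>w\<close> preserve maximal monotonicity, so
  it suffices to solve \<open>0 \<in> x + A' x\<close> for \<open>A' x = \<gamma> A x - w\<close>, which is the graph \<open>G\<close> of the proof.
\<close>
theorem Minty:
  fixes A :: "'h::{real_inner, complete_space} \<Rightarrow> 'h set"
  assumes A: "maximally_monotone A" and "\<gamma> > 0"
  shows "\<exists>p. w \<in> (\<lambda>u. p + u) ` scale_operator \<gamma> A p"
proof -
  define G where "G = {(y, v). (1 / \<gamma>) *\<^sub>R (v + w) \<in> A y}"
  have "\<exists>x. (x, - x) \<in> G"
  proof (rule Minty_graph)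
    fix x u y v
    assume "(x, u) \<in> G" "(y, v) \<in> G"
    then have "0 \<le> inner (x - y) ((1 / \<gamma>) *\<^sub>R (u + w) - (1 / \<gamma>) *\<^sub>R (v + w))"
      unfolding G_def using maximally_monotoneD(1)[OF A] by blast
    also have "\<dots> = inner (x - y) (u - v) / \<gamma>"
      by (simp add: scaleR_diff_right[symmetric])
    finally show "0 \<le> inner (x - y) (u - v)"
      using \<open>\<gamma> > 0\<close> by (simp add: zero_le_divide_iff)
  next
    fix x u
    assume rel: "\<And>y v. (y, v) \<in> G \<Longrightarrow> 0 \<le> inner (x - y) (u - v)"
    have "(1 / \<gamma>) *\<^sub>R (u + w) \<in> A x"
    proof (rule maximally_monotoneD(2)[OF A])
      fix y v
      assume "v \<in> A y"
      then have "(y, \<gamma> *\<^sub>R v - w) \<in> G"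
        using \<open>\<gamma> > 0\<close> by (simp add: G_def)
      then have "0 \<le> inner (x - y) (u - (\<gamma> *\<^sub>R v - w)) / \<gamma>"
        using rel \<open>\<gamma> > 0\<close> by simp
      also have "\<dots> = inner (x - y) ((1 / \<gamma>) *\<^sub>R (u - (\<gamma> *\<^sub>R v - w)))"
        by simp
      also have "(1 / \<gamma>) *\<^sub>R (u - (\<gamma> *\<^sub>R v - w)) = (1 / \<gamma>) *\<^sub>R (u + w) - v"
        using \<open>\<gamma> > 0\<close> by (simp add: algebra_simps)
      finally show "0 \<le> inner (x - y) ((1 / \<gamma>) *\<^sub>R (u + w) - v)" .
    qed
    then show "(x, u) \<in> G"
      by (simp add: G_def)
  qed
  then obtain x where x: "(1 / \<gamma>) *\<^sub>R (- x + w) \<in> A x"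
    by (auto simp: G_def)
  have "\<gamma> *\<^sub>R ((1 / \<gamma>) *\<^sub>R (- x + w)) \<in> scale_operator \<gamma> A x"
    unfolding scale_operator_def using x by (rule imageI)
  then have "w - x \<in> scale_operator \<gamma> A x"
    using \<open>\<gamma> > 0\<close> by simp
  then have "x + (w - x) \<in> (\<lambda>u. x + u) ` scale_operator \<gamma> A x"
    by (rule imageI)
  then show ?thesis
    by auto
qed

text \<open>
  Minty's theorem provides a solution of \<open>w \<in> p + \<gamma> A p\<close>, and monotonicity makes it unique, so the
  resolvent is a total function characterised by this inclusion.
\<close>
lemma resolvent_eq_iff:
  fixes A :: "'h::{real_inner, complete_space} \<Rightarrow> 'h set"
  assumes A: "maximally_monotone A" and "\<gamma> > 0"
  shows "resolvent (scale_operator \<gamma> A) w = p \<longleftrightarrow> (\<exists>u\<in>A p. w = p + \<gamma> *\<^sub>R u)"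
proof -
  define S where "S = {p. w \<in> (\<lambda>u. p + u) ` scale_operator \<gamma> A p}"
  have S_iff: "p \<in> S \<longleftrightarrow> (\<exists>u\<in>A p. w = p + \<gamma> *\<^sub>R u)" for p
    by (auto simp: S_def scale_operator_def)
  have unique: "p = p'" if "p \<in> S" "p' \<in> S" for p p'
  proof -
    from that obtain u u' where u: "u \<in> A p" "u' \<in> A p'" "p - p' = \<gamma> *\<^sub>R (u' - u)"
      unfolding S_iff by (auto simp: algebra_simps)
    have "(norm (p - p'))\<^sup>2 = inner (p - p') (\<gamma> *\<^sub>R (u' - u))"
      unfolding u(3)[symmetric] by (rule power2_norm_eq_inner)
    also have "\<dots> = - (\<gamma> * inner (p - p') (u - u'))"
      by (simp add: inner_diff algebra_simps)
    also have "\<dots> \<le> 0"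
      using maximally_monotoneD(1)[OF A u(1,2)] \<open>\<gamma> > 0\<close> by simp
    finally show ?thesis by simp
  qed
  obtain p0 where "p0 \<in> S"
    using Minty[OF assms, of w] by (auto simp: S_def)
  with unique have "S = {p0}"
    by blast
  then have "resolvent (scale_operator \<gamma> A) w = p0"
    by (simp add: resolvent_def S_def)
  then show ?thesis
    using \<open>S = {p0}\<close> S_iff[of p] by auto
qed

text \<open>
  With \<open>w = J w + \<gamma> u\<close> and \<open>w' = J w' + \<gamma> u'\<close> for suitable \<open>u \<in> A (J w)\<close> and \<open>u' \<in> A (J w')\<close>, the
  inequality is uniform monotonicity followed by Cauchy--Schwarz for \<open>\<langle>J w - J w', w - w'\<rangle>\<close>.
\<close>
lemma resolvent_uniformly_monotone:
  fixes A :: "'h::{real_inner, complete_space} \<Rightarrow> 'h set"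
  assumes A: "maximally_monotone A" and unif: "uniformly_monotone A \<phi>" and "\<gamma> > 0"
  defines "J \<equiv> resolvent (scale_operator \<gamma> A)"
  shows "(norm (J w - J w'))\<^sup>2 + \<gamma> * \<phi> (norm (J w - J w')) \<le> norm (J w - J w') * norm (w - w')"
proof -
  obtain u where u: "u \<in> A (J w)" "w = J w + \<gamma> *\<^sub>R u"
    using resolvent_eq_iff[OF A \<open>\<gamma> > 0\<close>, of w "J w"] by (auto simp: J_def)
  obtain u' where u': "u' \<in> A (J w')" "w' = J w' + \<gamma> *\<^sub>R u'"
    using resolvent_eq_iff[OF A \<open>\<gamma> > 0\<close>, of w' "J w'"] by (auto simp: J_def)
  define d where "d = J w - J w'"
  have "w - w' = d + \<gamma> *\<^sub>R (u - u')"
    using u(2) u'(2) unfolding d_def by (metis (no_types, lifting) add_diff_add scaleR_diff_right)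
  then have "inner d (w - w') = (norm d)\<^sup>2 + \<gamma> * inner d (u - u')"
    by (simp add: inner_add_right power2_norm_eq_inner)
  moreover have "\<phi> (norm d) \<le> inner d (u - u')"
    using unif u(1) u'(1) unfolding uniformly_monotone_def d_def by blast
  then have "\<gamma> * \<phi> (norm d) \<le> \<gamma> * inner d (u - u')"
    using \<open>\<gamma> > 0\<close> by simp
  ultimately show ?thesis
    using norm_cauchy_schwarz[of d "w - w'"] unfolding d_def by linarith
qed

section \<open>The averaged operator and its dependence on the measure\<close>

text \<open>
  Testing against a fixed vector reduces Hilbert-space valued expectations to ordinary real integrals.
  The approximating simple functions are tested as well.
\<close>
lemma has_expectation_inner:
  fixes f :: "'b \<Rightarrow> 'h::real_inner"
  assumes "has_expectation M f v"
  shows "has_bochner_integral M (\<lambda>\<xi>. inner (f \<xi>) e) (inner v e)"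
proof -
  from assms obtain s where f: "f \<in> borel_measurable M"
    and s: "\<And>i. Bochner_Integration.simple_bochner_integrable M (s i)"
    and lim0: "(\<lambda>i. \<integral>\<^sup>+\<xi>. ennreal (norm (f \<xi> - s i \<xi>)) \<partial>M) \<longlonglongrightarrow> 0"
    and lim: "(\<lambda>i. Bochner_Integration.simple_bochner_integral M (s i)) \<longlonglongrightarrow> v"
    unfolding has_expectation_def by blast
  \<comment> \<open>For \<open>\<parallel>e\<parallel> \<le> 1\<close> the error integrals are bounded by monotonicity alone. Pulling a constant out of
     \<open>\<integral>\<^sup>+\<close> would require measurability of \<open>f - s i\<close>, which is delicate when the space is not separable.\<close>
  have short: "has_bochner_integral M (\<lambda>\<xi>. inner (f \<xi>) e) (inner v e)" if "norm e \<le> 1" for e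
  proof (rule has_bochner_integral.intros[where s = "\<lambda>i \<xi>. inner (s i \<xi>) e"])
    have "(\<lambda>x. inner x e) \<in> borel_measurable borel"
      by (intro borel_measurable_continuous_onI continuous_intros)
    then show "(\<lambda>\<xi>. inner (f \<xi>) e) \<in> borel_measurable M"
      using f by (rule measurable_compose[rotated])
    show "Bochner_Integration.simple_bochner_integrable M (\<lambda>\<xi>. inner (s i \<xi>) e)" for i
      by (rule Bochner_Integration.simple_bochner_integrable_compose2
          [where p = "\<lambda>x y. inner x e", OF _ s s]) simp
    show "(\<lambda>i. \<integral>\<^sup>+\<xi>. ennreal (norm (inner (f \<xi>) e - inner (s i \<xi>) e)) \<partial>M) \<longlonglongrightarrow> 0"
    proof (rule tendsto_sandwich[OF _ _ tendsto_const lim0])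
      have "norm (inner x e - inner y e) \<le> norm (x - y)" for x y :: 'h
        using Cauchy_Schwarz_ineq2[of "x - y" e] mult_left_le[OF \<open>norm e \<le> 1\<close> norm_ge_zero[of "x - y"]]
        by (simp add: inner_diff_left)
      then show "\<forall>\<^sub>F i in sequentially. (\<integral>\<^sup>+\<xi>. ennreal (norm (inner (f \<xi>) e - inner (s i \<xi>) e)) \<partial>M)
          \<le> (\<integral>\<^sup>+\<xi>. ennreal (norm (f \<xi> - s i \<xi>)) \<partial>M)"
        by (intro always_eventually allI nn_integral_mono ennreal_leI)
    qed simp
    have "linear (\<lambda>x. inner x e)"
      by (intro bounded_linear.linear bounded_linear_inner_left)
    then have "Bochner_Integration.simple_bochner_integral M (\<lambda>\<xi>. inner (s i \<xi>) e)
        = inner (Bochner_Integration.simple_bochner_integral M (s i)) e" for i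
      using s by (rule Bochner_Integration.simple_bochner_integral_linear)
    then show "(\<lambda>i. Bochner_Integration.simple_bochner_integral M (\<lambda>\<xi>. inner (s i \<xi>) e)) \<longlonglongrightarrow> inner v e"
      using lim by (auto intro: tendsto_intros)
  qed
  have "norm (sgn e) \<le> 1"
    by (simp add: norm_sgn)
  then have "has_bochner_integral M (\<lambda>\<xi>. norm e * inner (f \<xi>) (sgn e)) (norm e * inner v (sgn e))"
    by (intro has_bochner_integral_mult_right short)
  moreover have "norm e * inner x (sgn e) = inner x e" for x :: 'h
    by (cases "e = 0") (simp_all add: sgn_div_norm)
  ultimately show ?thesis
    by simp
qed

lemma mean_operator_eq:
  fixes B :: "'h::real_inner \<Rightarrow> 'b \<Rightarrow> 'h"
  assumes "has_expectation M (B y) v"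
  shows "mean_operator B M y = v"
  unfolding mean_operator_def
proof (rule the_equality)
  fix w
  assume w: "has_expectation M (B y) w"
  have "inner w e = inner v e" for e
    using has_expectation_inner[OF assms, of e] has_expectation_inner[OF w, of e]
    by (metis has_bochner_integral_eq)
  then show "w = v"
    by (metis vector_eq_rdot)
qed (fact assms)

lemma inner_mean_operator:
  fixes B :: "'h::real_inner \<Rightarrow> 'b \<Rightarrow> 'h"
  assumes "\<exists>v. has_expectation M (B y) v"
  shows "has_bochner_integral M (\<lambda>\<xi>. inner (B y \<xi>) e) (inner (mean_operator B M y) e)"
  using assms has_expectation_inner mean_operator_eq by metis

text \<open>
  Cocoercivity survives averaging because the squared norm of an expectation is at most the expected
  squared norm. Only its linearised form is integrated: \<open>\<parallel>d\<parallel>\<^sup>2 \<ge> 2 \<langle>d, b\<rangle> - \<parallel>b\<parallel>\<^sup>2\<close> for all \<open>d\<close>, whose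
  right-hand side has expectation \<open>\<parallel>b\<parallel>\<^sup>2\<close> when \<open>b\<close> is the mean of \<open>d\<close>. Square integrability is never an
  issue.
\<close>
lemma mean_operator_cocoercive:
  fixes B :: "'h::real_inner \<Rightarrow> 'b \<Rightarrow> 'h"
  assumes "prob_space M" and ex: "\<And>y. \<exists>v. has_expectation M (B y) v"
    and "\<theta> \<ge> 0"
    and coco: "AE \<xi> in M. \<theta> * (norm (B y \<xi> - B z \<xi>))\<^sup>2 \<le> inner (B y \<xi> - B z \<xi>) (y - z)"
  defines "b \<equiv> mean_operator B M y - mean_operator B M z"
  shows "\<theta> * (norm b)\<^sup>2 \<le> inner b (y - z)"
proof -
  interpret prob_space M by fact
  have diff: "has_bochner_integral M (\<lambda>\<xi>. inner (B y \<xi> - B z \<xi>) e) (inner b e)" for e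
    unfolding b_def inner_diff_left
    by (intro has_bochner_integral_diff inner_mean_operator ex)
  note int = integrable.intros[OF diff]
  have eq: "(\<integral>\<xi>. inner (B y \<xi> - B z \<xi>) e \<partial>M) = inner b e" for e
    using diff by (rule has_bochner_integral_integral_eq)
  have "(\<integral>\<xi>. \<theta> * (2 * inner (B y \<xi> - B z \<xi>) b - (norm b)\<^sup>2) \<partial>M)
      \<le> (\<integral>\<xi>. inner (B y \<xi> - B z \<xi>) (y - z) \<partial>M)"
  proof (rule integral_mono_AE)
    show "integrable M (\<lambda>\<xi>. \<theta> * (2 * inner (B y \<xi> - B z \<xi>) b - (norm b)\<^sup>2))"
      using int[of b] by auto
    have "2 * inner d b - (norm b)\<^sup>2 \<le> (norm d)\<^sup>2" for d
      using zero_le_power2[of "norm (d - b)"]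
      unfolding power2_norm_eq_inner by (simp add: inner_diff inner_commute)
    then have "\<theta> * (2 * inner d b - (norm b)\<^sup>2) \<le> \<theta> * (norm d)\<^sup>2" for d
      using \<open>\<theta> \<ge> 0\<close> by (intro mult_left_mono)
    with coco show "AE \<xi> in M. \<theta> * (2 * inner (B y \<xi> - B z \<xi>) b - (norm b)\<^sup>2)
        \<le> inner (B y \<xi> - B z \<xi>) (y - z)"
      by (auto elim!: eventually_mono intro: order_trans)
  qed (rule int)
  also have "(\<integral>\<xi>. \<theta> * (2 * inner (B y \<xi> - B z \<xi>) b - (norm b)\<^sup>2) \<partial>M) = \<theta> * (norm b)\<^sup>2"
    using int[of b] by (simp add: eq prob_space power2_norm_eq_inner)
  finally show ?thesis
    by (simp add: eq)
qed

text \<open>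
  Applied to \<open>d = x - y\<close> and \<open>b\<close> the difference of the values of a \<open>\<theta>\<close>-cocoercive operator, this is
  nonexpansiveness of the explicit step: \<open>\<parallel>d - \<gamma> b\<parallel>\<^sup>2 \<le> \<parallel>d\<parallel>\<^sup>2 - \<gamma> (2 \<theta> - \<gamma>) \<parallel>b\<parallel>\<^sup>2\<close>.
\<close>
lemma forward_step_nonexpansive:
  fixes d b :: "'h::real_inner"
  assumes "\<theta> * (norm b)\<^sup>2 \<le> inner b d" and "0 \<le> \<gamma>" "\<gamma> \<le> 2 * \<theta>"
  shows "norm (d - \<gamma> *\<^sub>R b) \<le> norm d"
proof (rule power2_le_imp_le)
  have "(norm (d - \<gamma> *\<^sub>R b))\<^sup>2 = (norm d)\<^sup>2 - 2 * \<gamma> * inner b d + \<gamma>\<^sup>2 * (norm b)\<^sup>2"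
    unfolding power2_norm_eq_inner
    by (simp add: inner_diff inner_commute algebra_simps power2_eq_square)
  also have "2 * \<gamma> * inner b d \<ge> 2 * \<gamma> * (\<theta> * (norm b)\<^sup>2)"
    using assms by (intro mult_left_mono) auto
  then have "(norm d)\<^sup>2 - 2 * \<gamma> * inner b d + \<gamma>\<^sup>2 * (norm b)\<^sup>2
      \<le> (norm d)\<^sup>2 - \<gamma> * (2 * \<theta> - \<gamma>) * (norm b)\<^sup>2"
    by (simp add: algebra_simps power2_eq_square)
  also have "\<dots> \<le> (norm d)\<^sup>2"
    using assms by simp
  finally show "(norm (d - \<gamma> *\<^sub>R b))\<^sup>2 \<le> (norm d)\<^sup>2" .
qed simp

text \<open>
  Let \<open>b\<close> be the difference of the two means. Its norm is \<open>\<langle>b, sgn b\<rangle>\<close>, and the test function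
  \<open>\<xi> \<mapsto> \<langle>B y \<xi>, sgn b\<rangle> / \<beta>\<close> is 1-Lipschitz and integrable for both measures.
\<close>
lemma mean_operator_wasserstein1:
  fixes B :: "'h::real_inner \<Rightarrow> 'b::metric_space \<Rightarrow> 'h"
  assumes lip: "\<beta>-lipschitz_on UNIV (B y)" and "\<beta> > 0"
    and exM: "\<exists>v. has_expectation M (B y) v" and exN: "\<exists>v. has_expectation N (B y) v"
    and W: "wasserstein1 M N \<le> ennreal c" and "c \<ge> 0"
  shows "norm (mean_operator B M y - mean_operator B N y) \<le> \<beta> * c"
proof -
  define b where "b = mean_operator B M y - mean_operator B N y"
  define h where "h \<xi> = inner (B y \<xi>) (sgn b) / \<beta>" for \<xi>
  have M: "has_bochner_integral M h (inner (mean_operator B M y) (sgn b) / \<beta>)"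
    and N: "has_bochner_integral N h (inner (mean_operator B N y) (sgn b) / \<beta>)"
    unfolding h_def by (intro has_bochner_integral_divide_zero inner_mean_operator exM exN)+
  have "1-lipschitz_on UNIV h"
  proof (rule lipschitz_onI)
    fix \<xi> \<eta> :: 'b
    have "dist (h \<xi>) (h \<eta>) = \<bar>inner (B y \<xi> - B y \<eta>) (sgn b)\<bar> / \<beta>"
      using \<open>\<beta> > 0\<close> by (simp add: h_def dist_real_def inner_diff_left diff_divide_distrib[symmetric])
    also have "\<dots> \<le> norm (B y \<xi> - B y \<eta>) / \<beta>"
      using \<open>\<beta> > 0\<close> Cauchy_Schwarz_ineq2[of "B y \<xi> - B y \<eta>" "sgn b"]
      by (intro divide_right_mono) (auto simp: norm_sgn split: if_splits)
    also have "\<dots> \<le> 1 * dist \<xi> \<eta>"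
      using lipschitz_onD[OF lip, of \<xi> \<eta>] \<open>\<beta> > 0\<close> by (simp add: dist_norm[symmetric] field_simps)
    finally show "dist (h \<xi>) (h \<eta>) \<le> 1 * dist \<xi> \<eta>" .
  qed simp
  then have "ennreal \<bar>(\<integral>\<xi>. h \<xi> \<partial>M) - (\<integral>\<xi>. h \<xi> \<partial>N)\<bar> \<le> wasserstein1 M N"
    unfolding wasserstein1_def using M N by (intro SUP_upper) (auto simp: has_bochner_integral_iff)
  with W have "ennreal \<bar>(\<integral>\<xi>. h \<xi> \<partial>M) - (\<integral>\<xi>. h \<xi> \<partial>N)\<bar> \<le> ennreal c"
    by (rule order_trans[rotated])
  then have "\<bar>(\<integral>\<xi>. h \<xi> \<partial>M) - (\<integral>\<xi>. h \<xi> \<partial>N)\<bar> \<le> c"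
    using \<open>c \<ge> 0\<close> by simp
  moreover have "(\<integral>\<xi>. h \<xi> \<partial>M) - (\<integral>\<xi>. h \<xi> \<partial>N) = inner b (sgn b) / \<beta>"
    using M N by (simp add: has_bochner_integral_iff b_def inner_diff_left diff_divide_distrib)
  moreover have "inner b (sgn b) = norm b"
    by (cases "b = 0") (simp_all add: sgn_div_norm power2_norm_eq_inner[symmetric] power2_eq_square)
  ultimately show ?thesis
    using \<open>\<beta> > 0\<close> by (simp add: b_def[symmetric] field_simps)
qed

section \<open>Existence and uniqueness of equilibria\<close>

theorem proposition1:
  fixes A :: "'h::{real_inner, complete_space} \<Rightarrow> 'h set"
    and B :: "'h \<Rightarrow> 'b::polish_space \<Rightarrow> 'h"
    and m :: "'h \<Rightarrow> 'b measure"
    and \<phi> :: "real \<Rightarrow> real"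
    and \<beta> \<theta> \<tau> \<gamma> :: real
  assumes prob: "\<And>x. prob_space (m x)" "\<And>x. sets (m x) = sets borel"
    and well_defined: "\<And>x y. \<exists>v. has_expectation (m x) (B y) v"
    and A_max: "maximally_monotone A"
    and beta: "\<beta> > 0"
    and B_meas: "\<And>x. B x \<in> borel_measurable (m x)"
    and B_lip: "\<And>x. \<beta>-lipschitz_on UNIV (B x)"
    and theta: "\<theta> > 0"
    and B_coco: "\<And>x. AE \<xi> in m x. \<forall>y z.
        \<theta> * (norm (B y \<xi> - B z \<xi>))\<^sup>2 \<le> inner (B y \<xi> - B z \<xi>) (y - z)"
    and tau: "\<tau> > 0"
    and W1_lip: "\<And>x y. wasserstein1 (m x) (m y) \<le> ennreal (\<tau> * norm (x - y))"
    and A_unif: "uniformly_monotone A \<phi>"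
    and phi_nonneg: "\<And>t. t \<ge> 0 \<Longrightarrow> \<phi> t \<ge> 0"
    and phi_cont: "continuous_on {0..} \<phi>"
    and phi_strict: "strict_mono_on {0..} \<phi>"
    and phi_0: "\<phi> 0 = 0"
    and phi_quot: "mono_on {0<..} (\<lambda>t. \<phi> t / t)"
    and phi_gt: "\<And>t. t > 0 \<Longrightarrow> \<phi> t > \<beta> * \<tau> * t\<^sup>2"
    and gamma: "\<gamma> \<in> {0<..<2 * \<theta>}"
  shows "(\<exists>!x. equilibrium A B m x) \<and>
    (\<forall>x. equilibrium A B m x \<longleftrightarrow> (\<forall>l>0. fb_residual A B l \<gamma> (m x) x = 0)) \<and>
    (\<forall>x. (\<forall>l>0. fb_residual A B l \<gamma> (m x) x = 0) \<longleftrightarrow>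
         x = resolvent (scale_operator \<gamma> A) (x - \<gamma> *\<^sub>R mean_operator B (m x) x))"
proof -
  have g: "\<gamma> > 0" "\<gamma> < 2 * \<theta>"
    using gamma by auto
  define J where "J = resolvent (scale_operator \<gamma> A)"
  define R where "R x = x - \<gamma> *\<^sub>R mean_operator B (m x) x" for x
  define F where "F x = J (R x)" for x
  define L where "L = 1 + \<gamma> * (\<beta> * \<tau>)"
  have "L > 0"
    using g beta tau by (simp add: L_def add_pos_pos)
  have forward: "norm (R x - R y) \<le> L * norm (x - y)" for x y
  proof -
    \<comment> \<open>The change of \<open>B\<^sub>m\<close> splits into \<open>b\<close>, which moves the point under the measure \<open>m x\<close> and
       is controlled by cocoercivity, and \<open>c\<close>, which moves the measure at the point \<open>y\<close>.\<close>
    define b where "b = mean_operator B (m x) x - mean_operator B (m x) y"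
    define c where "c = mean_operator B (m x) y - mean_operator B (m y) y"
    have "\<theta> * (norm b)\<^sup>2 \<le> inner b (x - y)"
      unfolding b_def by (rule mean_operator_cocoercive[OF prob(1) well_defined])
        (use B_coco[of x] theta in \<open>auto elim: eventually_mono\<close>)
    then have "norm ((x - y) - \<gamma> *\<^sub>R b) \<le> norm (x - y)"
      by (rule forward_step_nonexpansive) (use g in auto)
    moreover have "norm c \<le> \<beta> * (\<tau> * norm (x - y))"
      unfolding c_def
      by (rule mean_operator_wasserstein1[OF B_lip beta well_defined well_defined W1_lip])
        (use tau in simp)
    then have "norm (\<gamma> *\<^sub>R c) \<le> \<gamma> * (\<beta> * (\<tau> * norm (x - y)))"
      using g by simp
    moreover have "R x - R y = ((x - y) - \<gamma> *\<^sub>R b) - \<gamma> *\<^sub>R c"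
      by (simp add: R_def b_def c_def algebra_simps)
    ultimately have "norm (R x - R y) \<le> norm (x - y) + \<gamma> * (\<beta> * (\<tau> * norm (x - y)))"
      by (smt (verit) norm_triangle_ineq4)
    then show ?thesis
      by (simp add: L_def algebra_simps)
  qed
  have fixed: "\<exists>!x. F x = x"
  proof (rule Meir_Keeler_fixed_point)
    fix \<epsilon> :: real
    assume "\<epsilon> > 0"
    \<comment> \<open>The two bounds combine to \<open>d + \<gamma> \<phi> d / d \<le> L * \<parallel>x - y\<parallel>\<close> for \<open>d = \<parallel>F x - F y\<parallel>\<close>. The left side is
       nondecreasing in \<open>d\<close>, and \<open>L * (\<epsilon> + \<delta>)\<close> is its value at \<open>d = \<epsilon>\<close>; so \<open>\<parallel>x - y\<parallel> < \<epsilon> + \<delta>\<close> rules out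
       \<open>d \<ge> \<epsilon>\<close>.\<close>
    define \<delta> where "\<delta> = \<gamma> * (\<phi> \<epsilon> / \<epsilon> - \<beta> * \<tau> * \<epsilon>) / L"
    have "\<phi> \<epsilon> / \<epsilon> > \<beta> * \<tau> * \<epsilon>"
      using phi_gt[of \<epsilon>] \<open>\<epsilon> > 0\<close> by (simp add: field_simps power2_eq_square)
    then have "\<delta> > 0"
      using g \<open>L > 0\<close> by (simp add: \<delta>_def)
    have L\<delta>: "L * (\<epsilon> + \<delta>) = \<epsilon> + \<gamma> * (\<phi> \<epsilon> / \<epsilon>)"
    proof -
      have "L * \<delta> = \<gamma> * (\<phi> \<epsilon> / \<epsilon> - \<beta> * \<tau> * \<epsilon>)"
        using \<open>L > 0\<close> by (simp add: \<delta>_def)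
      then show ?thesis by (simp add: distrib_left) (simp add: L_def algebra_simps)
    qed
    have "dist (F x) (F y) < \<epsilon>" if "dist x y < \<epsilon> + \<delta>" for x y
    proof (rule ccontr)
      define d where "d = norm (F x - F y)"
      assume "\<not> dist (F x) (F y) < \<epsilon>"
      then have d: "\<epsilon> \<le> d" "d > 0"
        using \<open>\<epsilon> > 0\<close> by (auto simp: d_def dist_norm)
      have "\<epsilon> + \<gamma> * (\<phi> \<epsilon> / \<epsilon>) \<le> d + \<gamma> * (\<phi> d / d)"
        using d \<open>\<epsilon> > 0\<close> g phi_quot
        by (intro add_mono mult_left_mono) (auto simp: mono_on_def)
      also have "\<dots> \<le> norm (R x - R y)"
      proof -
        have "d\<^sup>2 + \<gamma> * \<phi> d \<le> d * norm (R x - R y)"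
          unfolding d_def F_def J_def
          by (rule resolvent_uniformly_monotone[OF A_max A_unif g(1)])
        also have "d\<^sup>2 + \<gamma> * \<phi> d = d * (d + \<gamma> * (\<phi> d / d))"
          using d by (simp add: field_simps power2_eq_square)
        finally have "d * (d + \<gamma> * (\<phi> d / d)) \<le> d * norm (R x - R y)" .
        then show ?thesis
          using d by simp
      qed
      also have "\<dots> \<le> L * norm (x - y)"
        by (rule forward)
      also have "\<dots> < L * (\<epsilon> + \<delta>)"
        using that \<open>L > 0\<close> by (simp add: dist_norm)
      finally show False
        by (simp add: L\<delta>)
    qed
    with \<open>\<delta> > 0\<close> show "\<exists>\<delta>>0. \<forall>x y. dist x y < \<epsilon> + \<delta> \<longrightarrow> dist (F x) (F y) < \<epsilon>"
      by blast
  qed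
  have equil: "equilibrium A B m x \<longleftrightarrow> F x = x" for x
  proof -
    have "F x = x \<longleftrightarrow> (\<exists>u\<in>A x. \<gamma> *\<^sub>R (u + mean_operator B (m x) x) = 0)"
      unfolding F_def J_def resolvent_eq_iff[OF A_max g(1)] R_def
      by (simp add: scaleR_add_right algebra_simps eq_neg_iff_add_eq_0)
    also have "\<dots> \<longleftrightarrow> equilibrium A B m x"
      using g unfolding equilibrium_def by force
    finally show ?thesis by simp
  qed
  have resid: "(\<forall>l>0. fb_residual A B l \<gamma> (m x) x = 0) \<longleftrightarrow> F x = x" for x
  proof -
    have "(\<forall>l>0. fb_residual A B l \<gamma> (m x) x = 0) \<longleftrightarrow> (\<forall>l::real>0. x - F x = 0)"
      unfolding fb_residual_def F_def J_def R_def by simp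
    also have "\<dots> \<longleftrightarrow> F x = x"
      using gt_ex[of "0::real"] by auto
    finally show ?thesis .
  qed
  show ?thesis
    unfolding equil resid J_def[symmetric] R_def[symmetric] F_def[symmetric]
    using fixed by (metis (no_types))
qed

end
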